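(* Let $d\geq 4$, $k\geq 1$ and $n_1,\dots,n_{d-1}\geq 1$ be integers, and let $s_{k,n_1,\dots,n_{d-1}}$ be the number of parallelogram polyhypercubes of dimension $d$, width $k$, and whose $i$-th height equals $n_i$ for $i=1,\dots,d-1$. Then $$s_{k,n_1,\dots,n_{d-1}}=\frac{1}{k^{d-1}}\prod_{i=1}^{d-1}\frac{n_i}{n_i+k-1}\binom{n_i+k-1}{k-1}^2.$$
   Context: A $d$-dimensional polyhypercube is a finite set of unit hypercubes of $\mathbb{Z}^d$ (coordinates $(c_1,\dots,c_d)$), considered up to translation. A plateau is a set of cells with a single common first coordinate forming a full box $\{c: \beta_r\le c_r\le \tau_r \text{ for } 2\le r\le d\}$; for direction $r$ its bottom is $\beta_r$ and top $\tau_r$. A parallelogram polyhypercube of width $k$ is a union of $k$ plateaus $P_1,\dots,P_k$ at consecutive first coordinates $1,\dots,k$ such that for every $r\in\{2,\dots,d\}$ the bottoms $\beta_r(P_\ell)$ and tops $\tau_r(P_\ell)$ are weakly increasing in $\ell$ and $\beta_r(P_{\ell+1})\le\tau_r(P_\ell)$ for $1\le\ell\le k-1$. Its width is $k$ and its $i$-th height ($1\le i\le d-1$) is the number of distinct values of the coordinate $c_{i+1}$ among its cells, i.e. $\tau_{i+1}(P_k)-\beta_{i+1}(P_1)+1$. *)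

theory Defs
  imports Complex_Main "HOL-Library.FuncSet"
begin

text \<open>A unit hypercube of \<open>\<int>\<^sup>d\<close> is identified with its coordinate vector, a function
  that is extensional on \<open>{1..d}\<close>, so that set equality compares only the \<open>d\<close> coordinates.\<close>

definition cells :: "nat \<Rightarrow> (nat \<Rightarrow> int) set" where
  "cells d = {1..d} \<rightarrow>\<^sub>E UNIV"

definition translate :: "nat \<Rightarrow> (nat \<Rightarrow> int) \<Rightarrow> (nat \<Rightarrow> int) set \<Rightarrow> (nat \<Rightarrow> int) set" where
  "translate d v S = (\<lambda>c. \<lambda>r\<in>{1..d}. c r + v r) ` S"

definition finite_cell_sets :: "nat \<Rightarrow> (nat \<Rightarrow> int) set set" where
  "finite_cell_sets d = {S. finite S \<and> S \<subseteq> cells d}"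

definition translation_rel :: "nat \<Rightarrow> ((nat \<Rightarrow> int) set \<times> (nat \<Rightarrow> int) set) set" where
  "translation_rel d =
     {(S, T). S \<in> finite_cell_sets d \<and> T \<in> finite_cell_sets d \<and> (\<exists>v. T = translate d v S)}"

definition polyhypercubes :: "nat \<Rightarrow> (nat \<Rightarrow> int) set set set" where
  "polyhypercubes d = finite_cell_sets d // translation_rel d"

definition plateau :: "nat \<Rightarrow> int \<Rightarrow> (nat \<Rightarrow> int) \<Rightarrow> (nat \<Rightarrow> int) \<Rightarrow> (nat \<Rightarrow> int) set" where
  "plateau d a \<beta> \<tau> = {c \<in> cells d. c 1 = a \<and> (\<forall>r\<in>{2..d}. \<beta> r \<le> c r \<and> c r \<le> \<tau> r)}"

text \<open>\<open>\<beta> l r\<close> and \<open>\<tau> l r\<close> are the bottom and the top of the \<open>l\<close>-th plateau in direction \<open>r\<close>;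
  \<open>\<beta> l r \<le> \<tau> l r\<close> says that the plateau is nonempty.\<close>

definition is_parallelogram :: "nat \<Rightarrow> nat \<Rightarrow> (nat \<Rightarrow> int) set \<Rightarrow> bool" where
  "is_parallelogram d k S \<longleftrightarrow>
     (\<exists>\<beta> \<tau> :: nat \<Rightarrow> nat \<Rightarrow> int.
        S = (\<Union>l\<in>{1..k}. plateau d (int l) (\<beta> l) (\<tau> l)) \<and>
        (\<forall>r\<in>{2..d}.
           (\<forall>l\<in>{1..k}. \<beta> l r \<le> \<tau> l r) \<and>
           mono_on {1..k} (\<lambda>l. \<beta> l r) \<and>
           mono_on {1..k} (\<lambda>l. \<tau> l r) \<and>
           (\<forall>l\<in>{1..<k}. \<beta> (l + 1) r \<le> \<tau> l r)))"

definition height :: "nat \<Rightarrow> (nat \<Rightarrow> int) set \<Rightarrow> nat" where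
  "height i S = card ((\<lambda>c. c (i + 1)) ` S)"

definition parallelogram_polyhypercubes ::
    "nat \<Rightarrow> nat \<Rightarrow> (nat \<Rightarrow> nat) \<Rightarrow> (nat \<Rightarrow> int) set set set" where
  "parallelogram_polyhypercubes d k n =
     {X \<in> polyhypercubes d.
        \<exists>S\<in>X. is_parallelogram d k S \<and> (\<forall>i\<in>{1..d - 1}. height i S = n i)}"

lemma equiv_translation_rel: "equiv (finite_cell_sets d) (translation_rel d)"
proof (rule equivI)
  show "translation_rel d \<subseteq> finite_cell_sets d \<times> finite_cell_sets d"
    by (auto simp: translation_rel_def)
  have id: "translate d (\<lambda>_. 0) S = S" if "S \<subseteq> cells d" for S
  proof -
    have "(\<lambda>r\<in>{1..d}. c r + 0) = c" if "c \<in> S" for c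
      using that \<open>S \<subseteq> cells d\<close> by (auto simp: cells_def PiE_def extensional_restrict)
    then show ?thesis by (auto simp: translate_def)
  qed
  have comp: "translate d w (translate d v S) = translate d (\<lambda>r. v r + w r) S" for v w S
  proof -
    have "(\<lambda>r\<in>{1..d}. (\<lambda>r\<in>{1..d}. c r + v r) r + w r) = (\<lambda>r\<in>{1..d}. c r + (v r + w r))"
      for c :: "nat \<Rightarrow> int"
      by (rule ext) (simp add: restrict_def add.assoc)
    then show ?thesis by (simp add: translate_def image_image)
  qed
  show "refl_on (finite_cell_sets d) (translation_rel d)"
  proof (rule refl_onI)
    fix S assume S: "S \<in> finite_cell_sets d"
    then have "S = translate d (\<lambda>_. 0) S" using id by (simp add: finite_cell_sets_def)
    with S show "(S, S) \<in> translation_rel d" unfolding translation_rel_def by blast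
  qed
  show "sym (translation_rel d)"
  proof (rule symI)
    fix S T assume "(S, T) \<in> translation_rel d"
    then obtain v where v: "S \<in> finite_cell_sets d" "T \<in> finite_cell_sets d" "T = translate d v S"
      by (auto simp: translation_rel_def)
    have "translate d (\<lambda>r. - v r) T = S"
      using v id[of S] by (simp add: comp finite_cell_sets_def)
    with v show "(T, S) \<in> translation_rel d"
      unfolding translation_rel_def by blast
  qed
  show "trans (translation_rel d)"
    by (rule transI) (auto simp: translation_rel_def comp)
qed

end

theory Submission
  imports Defs
begin

text \<open>
  The conditions on bottoms and tops do not relate different directions, so after normalising the
  first bottom to 0 the count is a product over the directions. In one direction of height \<open>n\<close>
  the first bottom is 0 and the last top is \<open>n - 1\<close>; the remaining data are the bottoms
  \<open>\<beta>\<^sub>2 \<le> \<dots> \<le> \<beta>\<^sub>k\<close> and the tops \<open>\<tau>\<^sub>1 \<le> \<dots> \<le> \<tau>\<^bsub>k-1\<^esub>\<close>, and all conditions reduce to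
  \<open>\<beta>\<^bsub>l+1\<^esub> \<le> \<tau>\<^sub>l\<close>. The number of pairs of weakly increasing sequences of length \<open>m\<close>, one below the
  other, with values bounded by \<open>x \<le> y\<close> respectively, is a two-by-two determinant of binomial
  coefficients, which follows by induction on \<open>m\<close> upon summing over the last entries. For
  \<open>m = k - 1\<close> and \<open>x = y = n - 1\<close> it is a Narayana number.
\<close>

section \<open>Counting pairs of weakly increasing sequences, one below the other\<close>

definition dominated_pairs :: "nat \<Rightarrow> nat \<Rightarrow> nat \<Rightarrow> ((nat \<Rightarrow> nat) \<times> (nat \<Rightarrow> nat)) set" where
  "dominated_pairs m x y =
     {(b, t). b \<in> {1..m} \<rightarrow>\<^sub>E {..x} \<and> t \<in> {1..m} \<rightarrow>\<^sub>E {..y} \<and>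
        mono_on {1..m} b \<and> mono_on {1..m} t \<and> (\<forall>l\<in>{1..m}. b l \<le> t l)}"

text \<open>A determinant of Lindstroem-Gessel-Viennot type. The entry \<open>y + m\<close> choose
  \<open>m - 1\<close> is written \<open>(y + m) choose Suc y\<close>, so that it is 0 for
  \<open>m = 0\<close>, where truncated subtraction would give 1.\<close>

definition dominated_count :: "nat \<Rightarrow> nat \<Rightarrow> nat \<Rightarrow> int" where
  "dominated_count m x y =
     int ((x + m) choose m) * int ((y + m) choose m) -
     int ((x + m) choose Suc m) * int ((y + m) choose Suc y)"

text \<open>The difference \<open>dominated_count (Suc m) x y - dominated_count (Suc m) (x - 1) y\<close>,
  for \<open>x > 0\<close>.\<close>

definition dominated_count_step :: "nat \<Rightarrow> nat \<Rightarrow> nat \<Rightarrow> int" where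
  "dominated_count_step m x y =
     int ((x + m) choose m) * int (Suc (y + m) choose Suc m) -
     int ((x + m) choose Suc m) * int (Suc (y + m) choose Suc y)"

lemma finite_dominated_pairs: "finite (dominated_pairs m x y)"
proof (rule finite_subset)
  show "dominated_pairs m x y \<subseteq> ({1..m} \<rightarrow>\<^sub>E {..x}) \<times> ({1..m} \<rightarrow>\<^sub>E {..y})"
    by (auto simp: dominated_pairs_def)
qed (auto intro!: finite_PiE)

text \<open>Pascal's rule in \<open>y\<close> makes the sum telescope. At the lower end
  \<open>y = x\<close>, it leaves two products that cancel by the symmetry of
  \<open>(x + m) choose m\<close>.\<close>

lemma sum_dominated_count:
  assumes "x \<le> y"
  shows "(\<Sum>y'=x..y. dominated_count m x y') = dominated_count_step m x y"
  using assms
proof (induction y rule: dec_induct)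
  case base
  have "(x + m) choose m = (x + m) choose x"
    using binomial_symmetric[of m "x + m"] by simp
  then show ?case
    by (simp add: dominated_count_def dominated_count_step_def algebra_simps)
next
  case (step y)
  then show ?case
    by (simp add: sum.nat_ivl_Suc' dominated_count_def dominated_count_step_def algebra_simps)
qed

text \<open>Telescopes by Pascal's rule in \<open>x\<close>.\<close>

lemma sum_dominated_count_step:
  "(\<Sum>x'\<le>x. dominated_count_step m x' y) = dominated_count (Suc m) x y"
  by (induction x) (simp_all add: binomial_eq_0 dominated_count_def dominated_count_step_def algebra_simps)

lemma mono_on_Suc_iff:
  fixes f :: "nat \<Rightarrow> 'a::order"
  shows "mono_on {1..Suc m} f \<longleftrightarrow> mono_on {1..m} f \<and> (\<forall>l\<in>{1..m}. f l \<le> f (Suc m))"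
  by (auto simp: mono_on_def le_Suc_eq)

lemma mono_on_fun_upd_Suc:
  fixes f :: "nat \<Rightarrow> 'a::order"
  assumes "mono_on {1..m} f" "\<And>l. l \<in> {1..m} \<Longrightarrow> f l \<le> z"
  shows "mono_on {1..Suc m} (f(Suc m := z))"
  unfolding mono_on_Suc_iff using assms by (auto simp: mono_on_def)

text \<open>Splits off the last entries \<open>x'\<close> and \<open>y'\<close>. By monotonicity
  they bound all earlier entries of their sequences, so they become the bounds of the shorter pair;
  this is why the two sequences carry separate bounds.\<close>

lemma bij_betw_dominated_pairs_Suc:
  "bij_betw (\<lambda>((x', y'), b, t). (b(Suc m := x'), t(Suc m := y')))
     (SIGMA (x', y') : (SIGMA x' : {..x}. {x'..y}). dominated_pairs m x' y')
     (dominated_pairs (Suc m) x y)"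
proof (rule bij_betw_byWitness[where
      f' = "\<lambda>(b, t). ((b (Suc m), t (Suc m)), restrict b {1..m}, restrict t {1..m})"], goal_cases)
  case 1
  \<comment> \<open>\<open>Suc m\<close> lies outside \<open>{1..m}\<close>, so the restriction puts
    back the value \<open>undefined\<close> that an extensional function has there.\<close>
  have "restrict (f(Suc m := z)) {1..m} = f" if "f \<in> {1..m} \<rightarrow>\<^sub>E A" for f :: "nat \<Rightarrow> nat" and z A
    using that by (auto simp: fun_eq_iff restrict_def PiE_def extensional_def)
  then show ?case
    unfolding dominated_pairs_def by auto
next
  case 2
  have "(restrict f {1..m})(Suc m := f (Suc m)) = f" if "f \<in> {1..Suc m} \<rightarrow>\<^sub>E A"
    for f :: "nat \<Rightarrow> nat" and A
    using that by (auto simp: fun_eq_iff restrict_def PiE_def extensional_def)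
  then show ?case
    unfolding dominated_pairs_def by auto
next
  case 3
  have "(b(Suc m := x'), t(Suc m := y')) \<in> dominated_pairs (Suc m) x y"
    if "x' \<le> x" "x' \<le> y'" "y' \<le> y" "(b, t) \<in> dominated_pairs m x' y'" for x' y' b t
  proof -
    have bt: "b \<in> {1..m} \<rightarrow>\<^sub>E {..x'}" "t \<in> {1..m} \<rightarrow>\<^sub>E {..y'}" "mono_on {1..m} b"
      "mono_on {1..m} t" "\<And>l. l \<in> {1..m} \<Longrightarrow> b l \<le> t l"
      using that(4) by (auto simp: dominated_pairs_def)
    have le: "b l \<le> x'" "t l \<le> y'" if "l \<in> {1..m}" for l
      using PiE_mem[OF bt(1) that] PiE_mem[OF bt(2) that] by auto
    have "mono_on {1..Suc m} (b(Suc m := x'))" "mono_on {1..Suc m} (t(Suc m := y'))"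
      using bt(3,4) le by (blast intro: mono_on_fun_upd_Suc)+
    moreover have "b \<in> {1..m} \<rightarrow>\<^sub>E {..x}" "t \<in> {1..m} \<rightarrow>\<^sub>E {..y}"
      using bt(1,2) that(1,3) PiE_mono[of "{1..m}" "\<lambda>_. {..x'}" "\<lambda>_. {..x}"]
        PiE_mono[of "{1..m}" "\<lambda>_. {..y'}" "\<lambda>_. {..y}"] by auto
    then have "b(Suc m := x') \<in> {1..Suc m} \<rightarrow>\<^sub>E {..x}" "t(Suc m := y') \<in> {1..Suc m} \<rightarrow>\<^sub>E {..y}"
      using that by (auto simp: atLeastAtMostSuc_conv intro!: PiE_fun_upd)
    ultimately show ?thesis
      using bt that by (auto simp: dominated_pairs_def)
  qed
  then show ?case by auto
next
  case 4
  have "b (Suc m) \<le> x \<and> b (Suc m) \<le> t (Suc m) \<and> t (Suc m) \<le> y \<and>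
      (restrict b {1..m}, restrict t {1..m}) \<in> dominated_pairs m (b (Suc m)) (t (Suc m))"
    if "(b, t) \<in> dominated_pairs (Suc m) x y" for b t
  proof -
    have bt: "b \<in> {1..Suc m} \<rightarrow>\<^sub>E {..x}" "t \<in> {1..Suc m} \<rightarrow>\<^sub>E {..y}" "mono_on {1..Suc m} b"
      "mono_on {1..Suc m} t" "\<And>l. l \<in> {1..Suc m} \<Longrightarrow> b l \<le> t l"
      using that by (auto simp: dominated_pairs_def)
    have "b (Suc m) \<le> x" "t (Suc m) \<le> y" "b (Suc m) \<le> t (Suc m)"
      using PiE_mem[OF bt(1), of "Suc m"] PiE_mem[OF bt(2), of "Suc m"] bt(5)[of "Suc m"] by auto
    moreover have "restrict b {1..m} \<in> {1..m} \<rightarrow>\<^sub>E {..b (Suc m)}"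
      "restrict t {1..m} \<in> {1..m} \<rightarrow>\<^sub>E {..t (Suc m)}"
      using bt(3,4) unfolding mono_on_Suc_iff by auto
    moreover have "mono_on {1..m} (restrict b {1..m})" "mono_on {1..m} (restrict t {1..m})"
      using bt(3,4) by (auto simp: mono_on_def)
    ultimately show ?thesis
      using bt(5) by (auto simp: dominated_pairs_def)
  qed
  then show ?case by auto
qed

lemma card_dominated_pairs:
  assumes "x \<le> y"
  shows "int (card (dominated_pairs m x y)) = dominated_count m x y"
  using assms
proof (induction m arbitrary: x y)
  case 0
  have "dominated_pairs 0 x y = {(\<lambda>_. undefined, \<lambda>_. undefined)}"
    by (auto simp: dominated_pairs_def mono_on_def)
  then show ?case by (simp add: dominated_count_def)
next
  case (Suc m)
  have "card (dominated_pairs (Suc m) x y) =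
      card (SIGMA (x', y') : (SIGMA x' : {..x}. {x'..y}). dominated_pairs m x' y')"
    using bij_betw_same_card[OF bij_betw_dominated_pairs_Suc] by metis
  also have "\<dots> = (\<Sum>(x', y')\<in>(SIGMA x' : {..x}. {x'..y}). card (dominated_pairs m x' y'))"
    by (subst card_SigmaI) (auto simp: finite_dominated_pairs case_prod_unfold)
  also have "\<dots> = (\<Sum>x'\<le>x. \<Sum>y'=x'..y. card (dominated_pairs m x' y'))"
    by (subst sum.Sigma) auto
  also have "int \<dots> = (\<Sum>x'\<le>x. \<Sum>y'=x'..y. dominated_count m x' y')"
    by (simp add: Suc.IH)
  \<comment> \<open>Here \<open>x \<le> y\<close> enters: every \<open>x'\<close> in the range
    satisfies \<open>x' \<le> y\<close>, as the closed form of the inner sum requires.\<close>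
  also have "\<dots> = (\<Sum>x'\<le>x. dominated_count_step m x' y)"
    using Suc.prems by (intro sum.cong refl sum_dominated_count) auto
  finally show ?case by (simp add: sum_dominated_count_step)
qed

text \<open>For \<open>k = m + 1\<close> and \<open>n = N + 1\<close>, absorption turns every
  binomial into a rational multiple of \<open>A\<close>. The determinant becomes
  \<open>A^2 (1 - N m / ((N + 1) (m + 1)))\<close>, and
  \<open>(N + 1) (m + 1) - N m = N + m + 1\<close>.\<close>

lemma dominated_count_diagonal:
  assumes "k \<ge> 1" "n \<ge> 1"
  shows "real_of_int (dominated_count (k - 1) (n - 1) (n - 1)) =
    1 / real k * (real n / (real n + real k - 1) * (real ((n + k - 1) choose (k - 1)))\<^sup>2)"
proof -
  obtain m N where km: "k = Suc m" "n = Suc N"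
    using assms by (metis Suc_le_D One_nat_def)
  define A where "A = real ((N + m) choose m)"
  have s: "(N + m) choose N = (N + m) choose m"
    using binomial_symmetric[of m "N + m"] by simp
  have "real (Suc m * ((N + m) choose Suc m)) = real (N * ((N + m) choose m))"
    using binomial_absorb_comp[of "N + m" m] binomial_absorption[of m "N + m"]
    by (metis add_diff_cancel_right')
  then have 1: "real ((N + m) choose Suc m) = A * real N / real (Suc m)"
    unfolding A_def of_nat_mult by (metis mult.commute nonzero_mult_div_cancel_left of_nat_eq_0_iff nat.distinct(1))
  have "real (Suc N * ((N + m) choose Suc N)) = real (m * ((N + m) choose m))"
    using binomial_absorb_comp[of "N + m" N] binomial_absorption[of N "N + m"] s
    by (metis add_diff_cancel_left')
  then have 2: "real ((N + m) choose Suc N) = A * real m / real (Suc N)"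
    unfolding A_def of_nat_mult by (metis mult.commute nonzero_mult_div_cancel_left of_nat_eq_0_iff nat.distinct(1))
  have "Suc (N + m) choose m = Suc (N + m) choose Suc N"
    using binomial_symmetric[of m "Suc (N + m)"] by (simp add: Suc_diff_le)
  then have "real (Suc N * (Suc (N + m) choose m)) = real (Suc (N + m) * ((N + m) choose m))"
    using binomial_absorption[of N "Suc (N + m)"] s by (metis diff_Suc_1)
  then have 3: "real (Suc (N + m) choose m) = A * real (Suc (N + m)) / real (Suc N)"
    unfolding A_def of_nat_mult by (metis mult.commute nonzero_mult_div_cancel_left of_nat_eq_0_iff nat.distinct(1))
  have e: "real n + real k - 1 = real (Suc (N + m))" "n + k - 1 = Suc (N + m)"
    by (simp_all add: km)
  have "real_of_int (dominated_count (k - 1) (n - 1) (n - 1)) =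
      A * A - A * real N / real (Suc m) * (A * real m / real (Suc N))"
    by (simp add: km dominated_count_def 1 2 flip: A_def del: of_nat_Suc)
  also have "\<dots> = 1 / real (Suc m) * (real (Suc N) / real (Suc (N + m)) *
      (A * real (Suc (N + m)) / real (Suc N))\<^sup>2)"
  proof -
    have "real (Suc N) > 0" "real (Suc m) > 0" "real (Suc (N + m)) > 0" by simp_all
    then show ?thesis
      by (simp add: divide_simps power2_eq_square) (simp add: algebra_simps)
  qed
  finally show ?thesis
    unfolding e by (simp add: km 3 del: of_nat_Suc)
qed

section \<open>A single direction: strips and dominated pairs\<close>

definition strip :: "nat \<Rightarrow> (nat \<Rightarrow> int) \<Rightarrow> (nat \<Rightarrow> int) \<Rightarrow> bool" where
  "strip k b t \<longleftrightarrow> (\<forall>l\<in>{1..k}. b l \<le> t l) \<and> mono_on {1..k} b \<and> mono_on {1..k} t \<and>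
     (\<forall>l\<in>{1..<k}. b (l + 1) \<le> t l)"

text \<open>The sequence \<open>b\<close> of a dominated pair holds the bottoms of the plateaus 2 to \<open>k\<close>, shifted down
  by one index, and \<open>t\<close> holds the tops of the plateaus 1 to \<open>k - 1\<close>.\<close>

definition pair_bottom :: "(nat \<Rightarrow> nat) \<Rightarrow> nat \<Rightarrow> int" where
  "pair_bottom b l = (if l = 1 then 0 else int (b (l - 1)))"

definition pair_top :: "nat \<Rightarrow> nat \<Rightarrow> (nat \<Rightarrow> nat) \<Rightarrow> nat \<Rightarrow> int" where
  "pair_top k h t l = (if l = k then int h else int (t l))"

text \<open>Inverse to \<open>pair_bottom\<close> and \<open>pair_top\<close> once the strip is
  shifted to start at 0. On a strip \<open>b 1\<close> is the least of all values, so
  \<open>nat\<close> truncates nothing.\<close>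

definition strip_pair ::
    "nat \<Rightarrow> (nat \<Rightarrow> int) \<Rightarrow> (nat \<Rightarrow> int) \<Rightarrow> (nat \<Rightarrow> nat) \<times> (nat \<Rightarrow> nat)" where
  "strip_pair k b t =
     (\<lambda>l\<in>{1..k - 1}. nat (b (l + 1) - b 1), \<lambda>l\<in>{1..k - 1}. nat (t l - b 1))"

lemma strip_shift: "strip k (\<lambda>l. b l + v) (\<lambda>l. t l + v) \<longleftrightarrow> strip k b t"
  by (simp add: strip_def mono_on_def)

text \<open>Because of the index shift in \<open>pair_bottom\<close>, the domination
  \<open>b l \<le> t l\<close> is the contact condition between the plateaus \<open>l\<close> and
  \<open>l + 1\<close>.\<close>

lemma strip_of_dominated_pair:
  assumes "(b, t) \<in> dominated_pairs (k - 1) h h"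
  shows "strip k (pair_bottom b) (pair_top k h t)"
proof -
  have bt: "\<And>l. 1 \<le> l \<Longrightarrow> l < k \<Longrightarrow> b l \<le> h" "\<And>l. 1 \<le> l \<Longrightarrow> l < k \<Longrightarrow> t l \<le> h"
    "\<And>l. 1 \<le> l \<Longrightarrow> l < k \<Longrightarrow> b l \<le> t l"
    "\<And>i j. 1 \<le> i \<Longrightarrow> i \<le> j \<Longrightarrow> j < k \<Longrightarrow> b i \<le> b j"
    "\<And>i j. 1 \<le> i \<Longrightarrow> i \<le> j \<Longrightarrow> j < k \<Longrightarrow> t i \<le> t j"
  proof -
    have "mono_on {1..k - 1} b" "mono_on {1..k - 1} t" "b \<in> {1..k - 1} \<rightarrow>\<^sub>E {..h}"
      "t \<in> {1..k - 1} \<rightarrow>\<^sub>E {..h}" "\<And>l. l \<in> {1..k - 1} \<Longrightarrow> b l \<le> t l"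
      using assms by (auto simp: dominated_pairs_def)
    then show "\<And>l. 1 \<le> l \<Longrightarrow> l < k \<Longrightarrow> b l \<le> h" "\<And>l. 1 \<le> l \<Longrightarrow> l < k \<Longrightarrow> t l \<le> h"
      "\<And>l. 1 \<le> l \<Longrightarrow> l < k \<Longrightarrow> b l \<le> t l"
      "\<And>i j. 1 \<le> i \<Longrightarrow> i \<le> j \<Longrightarrow> j < k \<Longrightarrow> b i \<le> b j"
      "\<And>i j. 1 \<le> i \<Longrightarrow> i \<le> j \<Longrightarrow> j < k \<Longrightarrow> t i \<le> t j"
      by (auto elim!: monotone_onD)
  qed
  have mb: "mono_on {1..k} (pair_bottom b)"
    by (rule mono_onI) (auto simp: pair_bottom_def intro!: bt)
  have mt: "mono_on {1..k} (pair_top k h t)"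
    by (rule mono_onI) (auto simp: pair_top_def intro!: bt)
  have c: "pair_bottom b (l + 1) \<le> pair_top k h t l" if "l \<in> {1..<k}" for l
    using that bt by (auto simp: pair_bottom_def pair_top_def)
  \<comment> \<open>Below \<open>k\<close>, nonemptiness follows from contact: the bottom at
    \<open>l\<close> is at most the bottom at \<open>l + 1\<close>, hence at most the top at
    \<open>l\<close>. At \<open>k\<close> it is the bound \<open>h\<close>.\<close>
  have "pair_bottom b l \<le> pair_top k h t l" if "l \<in> {1..k}" for l
  proof (cases "l = k")
    case True
    then show ?thesis using that bt(1)[of "k - 1"] by (auto simp: pair_bottom_def pair_top_def)
  next
    case False
    then show ?thesis
      using that c[of l] monotone_onD[OF mb, of l "l + 1"] by auto
  qed
  with mb mt c show ?thesis by (simp add: strip_def)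
qed

lemma strip_pair_dominated:
  assumes "strip k b t" "k \<ge> 1" "t k - b 1 = int h"
  shows "strip_pair k b t \<in> dominated_pairs (k - 1) h h"
proof -
  have s: "\<And>l. 1 \<le> l \<Longrightarrow> l < k \<Longrightarrow> b (Suc l) \<le> t l"
    "\<And>i j. 1 \<le> i \<Longrightarrow> i \<le> j \<Longrightarrow> j \<le> k \<Longrightarrow> b i \<le> b j"
    "\<And>i j. 1 \<le> i \<Longrightarrow> i \<le> j \<Longrightarrow> j \<le> k \<Longrightarrow> t i \<le> t j" "b k \<le> t k"
    using assms by (auto simp: strip_def mono_on_def)
  \<comment> \<open>All bottoms are at most \<open>b k \<le> t k\<close>, all tops are at most
    \<open>t k\<close>, and \<open>t k = b 1 + h\<close>.\<close>
  have "nat (b (Suc l) - b 1) \<le> h \<and> nat (t l - b 1) \<le> h" if "1 \<le> l" "l < k" for l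
    using that s(2)[of "Suc l" k] s(3)[of l k] s(4) assms(3) by auto
  moreover have "nat (b (Suc i) - b 1) \<le> nat (b (Suc j) - b 1) \<and> nat (t i - b 1) \<le> nat (t j - b 1)"
    if "1 \<le> i" "i \<le> j" "j < k" for i j
    using that s(2)[of "Suc i" "Suc j"] s(3)[of i j] by (auto intro!: nat_mono)
  ultimately show ?thesis
    using s(1) by (auto simp: strip_pair_def dominated_pairs_def intro!: mono_onI nat_mono
        simp del: nat_le_eq_zle)
qed

text \<open>Together with \<open>top_strip_pair\<close>: passing to the pair and back only shifts
  the strip by \<open>- b 1\<close>.\<close>

lemma bottom_strip_pair:
  assumes "strip k b t" "l \<in> {1..k}"
  shows "pair_bottom (fst (strip_pair k b t)) l = b l - b 1"
  using assms by (auto simp: pair_bottom_def strip_pair_def strip_def mono_on_def)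

lemma top_strip_pair:
  assumes "strip k b t" "t k - b 1 = int h" "l \<in> {1..k}"
  shows "pair_top k h (snd (strip_pair k b t)) l = t l - b 1"
proof -
  have "b 1 \<le> b l" "b l \<le> t l"
    using assms by (auto simp: strip_def mono_on_def)
  then show ?thesis
    using assms(2,3) by (auto simp: pair_top_def strip_pair_def)
qed

text \<open>\<open>b l\<close> is visible at plateau \<open>l + 1\<close> and \<open>t l\<close> at
  plateau \<open>l\<close>; outside \<open>{1..k - 1}\<close> extensionality decides.\<close>

lemma dominated_pairs_eqI:
  assumes "(b, t) \<in> dominated_pairs (k - 1) h h" "(b', t') \<in> dominated_pairs (k - 1) h h"
    and b: "\<And>l. l \<in> {1..k} \<Longrightarrow> pair_bottom b l = pair_bottom b' l"
    and t: "\<And>l. l \<in> {1..k} \<Longrightarrow> pair_top k h t l = pair_top k h t' l"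
  shows "b = b' \<and> t = t'"
proof -
  have e: "b \<in> extensional {1..k - 1}" "t \<in> extensional {1..k - 1}"
    "b' \<in> extensional {1..k - 1}" "t' \<in> extensional {1..k - 1}"
    using assms(1,2) by (auto simp: dominated_pairs_def PiE_def)
  have "b l = b' l" "t l = t' l" if "l \<in> {1..k - 1}" for l
  proof -
    have "l \<noteq> k" "l \<in> {1..k}" "Suc l \<in> {1..k}" using that by auto
    then show "b l = b' l" "t l = t' l"
      using b[of "Suc l"] t[of l] by (simp_all add: pair_bottom_def pair_top_def)
  qed
  with e show ?thesis
    by (metis extensionalityI)
qed

text \<open>Contact makes successive intervals overlap, so their union has no gaps. Hence counting
  distinct coordinate values gives last top minus first bottom plus 1.\<close>

lemma UN_strip:
  assumes "strip k b t" "k \<ge> 1"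
  shows "(\<Union>l\<in>{1..k}. {b l..t l}) = {b 1..t k}"
  using assms(2,1)
proof (induction k rule: dec_induct)
  case base
  then show ?case by simp
next
  case (step k)
  have k: "strip k b t"
    using step.prems by (auto simp: strip_def mono_on_def)
  have *: "b 1 \<le> b (Suc k)" "t k \<le> t (Suc k)" "b (Suc k) \<le> t k"
    using step.prems step.hyps by (auto simp: strip_def mono_on_def)
  have "(\<Union>l\<in>{1..Suc k}. {b l..t l}) = (\<Union>l\<in>{1..k}. {b l..t l}) \<union> {b (Suc k)..t (Suc k)}"
    using step.hyps by (simp add: atLeastAtMostSuc_conv Un_commute)
  also have "\<dots> = {b 1..t (Suc k)}"
    unfolding step.IH[OF k] using * by auto
  finally show ?case .
qed

section \<open>Stacks of plateaus: reading bottoms and tops off the set of cells\<close>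

definition plateau_stack ::
    "nat \<Rightarrow> nat \<Rightarrow> (nat \<Rightarrow> nat \<Rightarrow> int) \<Rightarrow> (nat \<Rightarrow> nat \<Rightarrow> int) \<Rightarrow> (nat \<Rightarrow> int) set" where
  "plateau_stack d k \<beta> \<tau> = (\<Union>l\<in>{1..k}. plateau d (int l) (\<beta> l) (\<tau> l))"

lemma is_parallelogram_iff:
  "is_parallelogram d k S \<longleftrightarrow>
     (\<exists>\<beta> \<tau>. S = plateau_stack d k \<beta> \<tau> \<and> (\<forall>r\<in>{2..d}. strip k (\<lambda>l. \<beta> l r) (\<lambda>l. \<tau> l r)))"
  by (simp add: is_parallelogram_def plateau_stack_def strip_def)

lemma plateau_stack_cong:
  assumes "\<And>l r. l \<in> {1..k} \<Longrightarrow> r \<in> {2..d} \<Longrightarrow> \<beta> l r = \<beta>' l r \<and> \<tau> l r = \<tau>' l r"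
  shows "plateau_stack d k \<beta> \<tau> = plateau_stack d k \<beta>' \<tau>'"
  using assms by (fastforce simp: plateau_stack_def plateau_def)

lemma plateau_stack_finite_cells: "plateau_stack d k \<beta> \<tau> \<in> finite_cell_sets d"
proof -
  have "finite (plateau d a b t)" for a b t
  proof (rule finite_subset)
    \<comment> \<open>One finite codomain serves all coordinates: \<open>a\<close> covers the first
      one, the intervals cover the others.\<close>
    show "plateau d a b t \<subseteq> {1..d} \<rightarrow>\<^sub>E (\<Union>r\<in>{1..d}. insert a {b r..t r})"
    proof
      fix c assume c: "c \<in> plateau d a b t"
      have "c r \<in> insert a {b r..t r}" if "r \<in> {1..d}" for r
        using c that by (cases "r = 1") (auto simp: plateau_def)
      then show "c \<in> {1..d} \<rightarrow>\<^sub>E (\<Union>r\<in>{1..d}. insert a {b r..t r})"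
        using c by (intro PiE_I UN_I) (auto simp: plateau_def cells_def PiE_def extensional_def)
    qed
  qed (auto intro!: finite_PiE)
  then show ?thesis
    by (auto simp: finite_cell_sets_def plateau_stack_def plateau_def)
qed

text \<open>The cells alone determine bottoms and tops, which yields both the heights and the
  uniqueness of the data.\<close>

lemma plateau_stack_slice:
  assumes "\<And>r. r \<in> {2..d} \<Longrightarrow> strip k (\<lambda>l. \<beta> l r) (\<lambda>l. \<tau> l r)" "r \<in> {2..d}" "a \<in> {1..k}"
  shows "(\<lambda>c. c r) ` {c \<in> plateau_stack d k \<beta> \<tau>. c 1 = int a} = {\<beta> a r..\<tau> a r}"
proof (intro equalityI subsetI)
  fix z assume z: "z \<in> {\<beta> a r..\<tau> a r}"
  \<comment> \<open>The remaining coordinates sit at their bottoms, which are admissible because a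
    strip has no empty interval.\<close>
  define c where "c = (\<lambda>s\<in>{1..d}. if s = 1 then int a else if s = r then z else \<beta> a s)"
  have "c \<in> plateau d (int a) (\<beta> a) (\<tau> a)"
    using z assms by (auto simp: c_def plateau_def cells_def strip_def)
  moreover have "c 1 = int a" "c r = z"
    using assms(2) by (auto simp: c_def)
  ultimately show "z \<in> (\<lambda>c. c r) ` {c \<in> plateau_stack d k \<beta> \<tau>. c 1 = int a}"
    using assms(3) by (force simp: plateau_stack_def)
qed (use assms(2) in \<open>auto simp: plateau_stack_def plateau_def\<close>)

lemma plateau_stack_first_coordinates:
  assumes "\<And>r. r \<in> {2..d} \<Longrightarrow> strip k (\<lambda>l. \<beta> l r) (\<lambda>l. \<tau> l r)" "d \<ge> 2"
  shows "(\<lambda>c. c 1) ` plateau_stack d k \<beta> \<tau> = int ` {1..k}"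
proof (intro equalityI subsetI)
  fix z assume "z \<in> int ` {1..k}"
  then obtain a where a: "z = int a" "a \<in> {1..k}" by auto
  have "{\<beta> a 2..\<tau> a 2} \<noteq> {}"
    using assms a by (auto simp: strip_def)
  with plateau_stack_slice[of d k \<beta> \<tau> 2 a] assms a
  have "{c \<in> plateau_stack d k \<beta> \<tau>. c 1 = int a} \<noteq> {}" by fastforce
  then obtain c where "c \<in> plateau_stack d k \<beta> \<tau>" "c 1 = z"
    using a by blast
  then show "z \<in> (\<lambda>c. c 1) ` plateau_stack d k \<beta> \<tau>"
    by blast
qed (auto simp: plateau_stack_def plateau_def)

lemma height_plateau_stack:
  assumes "\<And>r. r \<in> {2..d} \<Longrightarrow> strip k (\<lambda>l. \<beta> l r) (\<lambda>l. \<tau> l r)" "k \<ge> 1" "i \<in> {1..d - 1}"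
  shows "int (height i (plateau_stack d k \<beta> \<tau>)) = \<tau> k (i + 1) - \<beta> 1 (i + 1) + 1"
proof -
  have r: "i + 1 \<in> {2..d}" using assms(3) by auto
  have "plateau_stack d k \<beta> \<tau> = (\<Union>a\<in>{1..k}. {c \<in> plateau_stack d k \<beta> \<tau>. c 1 = int a})"
    by (auto simp: plateau_stack_def plateau_def)
  then have "(\<lambda>c. c (i + 1)) ` plateau_stack d k \<beta> \<tau> =
      (\<Union>a\<in>{1..k}. (\<lambda>c. c (i + 1)) ` {c \<in> plateau_stack d k \<beta> \<tau>. c 1 = int a})"
    by (metis image_UN)
  also have "\<dots> = (\<Union>a\<in>{1..k}. {\<beta> a (i + 1)..\<tau> a (i + 1)})"
    using plateau_stack_slice[OF assms(1) r] by simp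
  also have "\<dots> = {\<beta> 1 (i + 1)..\<tau> k (i + 1)}"
    using UN_strip[OF assms(1)[OF r] assms(2)] .
  finally have "height i (plateau_stack d k \<beta> \<tau>) = nat (\<tau> k (i + 1) - \<beta> 1 (i + 1) + 1)"
    by (simp add: height_def)
  moreover have "\<beta> 1 (i + 1) \<le> \<beta> k (i + 1)" "\<beta> k (i + 1) \<le> \<tau> k (i + 1)"
    using assms(1)[OF r] assms(2) by (auto simp: strip_def mono_on_def)
  ultimately show ?thesis by simp
qed

lemma translate_plateau_stack:
  assumes "v 1 = 0" "d \<ge> 1"
  shows "translate d v (plateau_stack d k \<beta> \<tau>) =
    plateau_stack d k (\<lambda>l r. \<beta> l r + v r) (\<lambda>l r. \<tau> l r + v r)"
proof (intro equalityI subsetI)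
  fix c assume c: "c \<in> plateau_stack d k (\<lambda>l r. \<beta> l r + v r) (\<lambda>l r. \<tau> l r + v r)"
  define c' where "c' = (\<lambda>r\<in>{1..d}. c r - v r)"
  have "c = (\<lambda>r\<in>{1..d}. c' r + v r)"
    using c by (auto simp: c'_def plateau_stack_def plateau_def cells_def fun_eq_iff PiE_def
        extensional_def)
  moreover have "c' \<in> plateau_stack d k \<beta> \<tau>"
    using c assms by (force simp: c'_def plateau_stack_def plateau_def cells_def)
  ultimately show "c \<in> translate d v (plateau_stack d k \<beta> \<tau>)"
    unfolding translate_def by blast
qed (use assms in \<open>auto simp: translate_def plateau_stack_def plateau_def cells_def\<close>)

text \<open>Both stacks occupy exactly the first coordinates 1 to \<open>k\<close>, which forces
  \<open>v 1 = 0\<close>; comparing slices then gives the shift in every other direction.\<close>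

lemma plateau_stack_translate_eqD:
  assumes s: "\<And>r. r \<in> {2..d} \<Longrightarrow> strip k (\<lambda>l. \<beta> l r) (\<lambda>l. \<tau> l r)"
    and s': "\<And>r. r \<in> {2..d} \<Longrightarrow> strip k (\<lambda>l. \<beta>' l r) (\<lambda>l. \<tau>' l r)"
    and d: "d \<ge> 2" and k: "k \<ge> 1"
    and eq: "plateau_stack d k \<beta>' \<tau>' = translate d v (plateau_stack d k \<beta> \<tau>)"
    and l: "l \<in> {1..k}" and r: "r \<in> {2..d}"
  shows "\<beta>' l r = \<beta> l r + v r \<and> \<tau>' l r = \<tau> l r + v r"
proof -
  have "int ` {1..k} = (\<lambda>c. c 1) ` translate d v (plateau_stack d k \<beta> \<tau>)"
    using plateau_stack_first_coordinates[of d k \<beta>' \<tau>'] s' d eq by simp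
  also have "\<dots> = (\<lambda>z. z + v 1) ` (\<lambda>c. c 1) ` plateau_stack d k \<beta> \<tau>"
    using d by (simp add: translate_def image_image)
  also have "\<dots> = (\<lambda>z. z + v 1) ` int ` {1..k}"
    using plateau_stack_first_coordinates[of d k \<beta> \<tau>] s d by simp
  finally have *: "int ` {1..k} = (\<lambda>z. z + v 1) ` int ` {1..k}" .
  \<comment> \<open>That \<open>1 + v 1\<close> is in the range gives \<open>v 1 \<ge> 0\<close>;
    that 1 is in the shifted range gives \<open>v 1 \<le> 0\<close>.\<close>
  have "1 \<in> int ` {1..k}" "1 + v 1 \<in> int ` {1..k}"
    using k by (force, subst *, force)
  moreover from this(1) have "1 \<in> (\<lambda>z. z + v 1) ` int ` {1..k}" by (subst (asm) *)
  ultimately have "v 1 = 0" by auto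
  then have eq': "plateau_stack d k \<beta>' \<tau>' =
      plateau_stack d k (\<lambda>l r. \<beta> l r + v r) (\<lambda>l r. \<tau> l r + v r)"
    using eq translate_plateau_stack d by simp
  have sv: "strip k (\<lambda>l. \<beta> l r + v r) (\<lambda>l. \<tau> l r + v r)" if "r \<in> {2..d}" for r
    using s[OF that] by (simp add: strip_shift)
  have "{\<beta>' l r..\<tau>' l r} = {\<beta> l r + v r..\<tau> l r + v r}"
    using plateau_stack_slice[of d k \<beta>' \<tau>', OF s' r l]
      plateau_stack_slice[of d k "\<lambda>l r. \<beta> l r + v r" "\<lambda>l r. \<tau> l r + v r", OF sv r l] eq'
    by simp
  \<comment> \<open>Equal intervals have equal endpoints only when they are nonempty.\<close>
  moreover have "\<beta>' l r \<le> \<tau>' l r"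
    using s'[OF r] l by (auto simp: strip_def)
  ultimately show ?thesis by (auto simp: Icc_eq_Icc)
qed

section \<open>Polyhypercubes as families of dominated pairs\<close>

text \<open>Direction \<open>r\<close> has the height with index \<open>r - 1\<close>; as the first
  bottom is 0, the last top is that height minus 1.\<close>

definition stack_of_pairs ::
    "nat \<Rightarrow> nat \<Rightarrow> (nat \<Rightarrow> nat) \<Rightarrow> (nat \<Rightarrow> (nat \<Rightarrow> nat) \<times> (nat \<Rightarrow> nat)) \<Rightarrow> (nat \<Rightarrow> int) set" where
  "stack_of_pairs d k n p =
     plateau_stack d k (\<lambda>l r. pair_bottom (fst (p r)) l)
       (\<lambda>l r. pair_top k (n (r - 1) - 1) (snd (p r)) l)"

text \<open>Each class contains exactly one stack whose plateaus have first coordinates 1 to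
  \<open>k\<close> and whose first bottoms are all 0; the pairs encode that stack.\<close>

lemma bij_betw_parallelogram_polyhypercubes:
  assumes d: "d \<ge> 2" and k: "k \<ge> 1" and n: "\<And>i. i \<in> {1..d - 1} \<Longrightarrow> n i \<ge> 1"
  shows "bij_betw (\<lambda>p. translation_rel d `` {stack_of_pairs d k n p})
    (\<Pi>\<^sub>E r\<in>{2..d}. dominated_pairs (k - 1) (n (r - 1) - 1) (n (r - 1) - 1))
    (parallelogram_polyhypercubes d k n)"
    (is "bij_betw ?f ?D ?P")
proof -
  have strip: "strip k (pair_bottom (fst (p r))) (pair_top k (n (r - 1) - 1) (snd (p r)))"
    if "p \<in> ?D" "r \<in> {2..d}" for p r
    using that by (intro strip_of_dominated_pair) auto
  have into: "?f p \<in> ?P" if p: "p \<in> ?D" for p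
  proof -
    have fin: "stack_of_pairs d k n p \<in> finite_cell_sets d"
      by (simp add: stack_of_pairs_def plateau_stack_finite_cells)
    have "is_parallelogram d k (stack_of_pairs d k n p)"
      unfolding is_parallelogram_iff stack_of_pairs_def using strip[OF p] by blast
    moreover have "height i (stack_of_pairs d k n p) = n i" if i: "i \<in> {1..d - 1}" for i
    proof -
      have "int (height i (stack_of_pairs d k n p)) = int (n i - 1) + 1"
        unfolding stack_of_pairs_def
        using height_plateau_stack[OF strip[OF p] k i] by (simp add: pair_bottom_def pair_top_def)
      with n[OF i] show ?thesis by simp
    qed
    moreover have "stack_of_pairs d k n p \<in> ?f p"
      using equiv_class_self[OF equiv_translation_rel fin] .
    ultimately show ?thesis
      using fin by (auto simp: parallelogram_polyhypercubes_def polyhypercubes_def quotient_def)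
  qed
  have "inj_on ?f ?D"
  proof (rule inj_onI)
    fix p q assume p: "p \<in> ?D" and q: "q \<in> ?D" and eq: "?f p = ?f q"
    have "(stack_of_pairs d k n p, stack_of_pairs d k n q) \<in> translation_rel d"
      using eq eq_equiv_class[OF _ equiv_translation_rel]
      by (simp add: stack_of_pairs_def plateau_stack_finite_cells)
    then obtain v where v: "stack_of_pairs d k n q = translate d v (stack_of_pairs d k n p)"
      by (auto simp: translation_rel_def)
    have *: "pair_bottom (fst (q r)) l = pair_bottom (fst (p r)) l + v r \<and>
        pair_top k (n (r - 1) - 1) (snd (q r)) l = pair_top k (n (r - 1) - 1) (snd (p r)) l + v r"
      if "l \<in> {1..k}" "r \<in> {2..d}" for l r
      by (rule plateau_stack_translate_eqD[OF _ _ d k v[unfolded stack_of_pairs_def] that])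
        (use strip p q in auto)
    show "p = q"
    proof (rule PiE_ext[OF p q])
      fix r assume r: "r \<in> {2..d}"
      \<comment> \<open>Both stacks have first bottom 0, so comparing at \<open>l = 1\<close>
        excludes any shift.\<close>
      have "v r = 0"
        using *[of 1 r] k r by (simp add: pair_bottom_def)
      moreover have "p r \<in> dominated_pairs (k - 1) (n (r - 1) - 1) (n (r - 1) - 1)"
        "q r \<in> dominated_pairs (k - 1) (n (r - 1) - 1) (n (r - 1) - 1)"
        using p q r by auto
      ultimately show "p r = q r"
        using dominated_pairs_eqI[of "fst (p r)" "snd (p r)" k "n (r - 1) - 1" "fst (q r)" "snd (q r)"]
          *[OF _ r] by (simp add: prod_eq_iff)
    qed
  qed
  moreover have "?P \<subseteq> ?f ` ?D"
  proof
    fix X assume "X \<in> ?P"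
    then obtain S where X: "X \<in> finite_cell_sets d // translation_rel d" and S: "S \<in> X"
      "is_parallelogram d k S" and h: "\<And>i. i \<in> {1..d - 1} \<Longrightarrow> height i S = n i"
      by (auto simp: parallelogram_polyhypercubes_def polyhypercubes_def)
    obtain \<beta> \<tau> where S_eq: "S = plateau_stack d k \<beta> \<tau>"
      and st: "\<And>r. r \<in> {2..d} \<Longrightarrow> strip k (\<lambda>l. \<beta> l r) (\<lambda>l. \<tau> l r)"
      using S(2) unfolding is_parallelogram_iff by blast
    have diff: "\<tau> k r - \<beta> 1 r = int (n (r - 1) - 1)" if r: "r \<in> {2..d}" for r
    proof -
      have i: "r - 1 \<in> {1..d - 1}" using r by auto
      show ?thesis
        using height_plateau_stack[of d k \<beta> \<tau>, OF st k i] h[OF i] n[OF i] r by (simp add: S_eq)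
    qed
    define p where "p = (\<lambda>r\<in>{2..d}. strip_pair k (\<lambda>l. \<beta> l r) (\<lambda>l. \<tau> l r))"
    have p: "p \<in> ?D"
      using strip_pair_dominated[OF st k diff] by (auto simp: p_def)
    \<comment> \<open>Moves all first bottoms to 0 and keeps the first coordinates, which already
      start at 1.\<close>
    define v where "v r = (if r = 1 then 0 else - \<beta> 1 r)" for r
    have "stack_of_pairs d k n p = plateau_stack d k (\<lambda>l r. \<beta> l r + v r) (\<lambda>l r. \<tau> l r + v r)"
      unfolding stack_of_pairs_def
    proof (rule plateau_stack_cong)
      fix l r assume l: "l \<in> {1..k}" and r: "r \<in> {2..d}"
      show "pair_bottom (fst (p r)) l = \<beta> l r + v r \<and>
          pair_top k (n (r - 1) - 1) (snd (p r)) l = \<tau> l r + v r"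
        using bottom_strip_pair[OF st[OF r] l] top_strip_pair[OF st[OF r] diff[OF r] l] r
        by (simp add: p_def v_def)
    qed
    also have "\<dots> = translate d v S"
      unfolding S_eq using d by (subst translate_plateau_stack) (auto simp: v_def)
    finally have "stack_of_pairs d k n p = translate d v S" .
    moreover have "S \<in> finite_cell_sets d" "stack_of_pairs d k n p \<in> finite_cell_sets d"
      by (simp_all add: S_eq stack_of_pairs_def plateau_stack_finite_cells)
    ultimately have "(S, stack_of_pairs d k n p) \<in> translation_rel d"
      unfolding translation_rel_def by blast
    then have "?f p = translation_rel d `` {S}"
      using equiv_class_eq[OF equiv_translation_rel] by metis
    also have "\<dots> = X"
      using X S(1) equiv_translation_rel
      by (metis Image_singleton_iff equiv_class_eq quotientE)
    finally show "X \<in> ?f ` ?D" using p by blast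
  qed
  ultimately show ?thesis
    using into unfolding bij_betw_def by blast
qed

theorem theorem6:
  fixes d k :: nat and n :: "nat \<Rightarrow> nat"
  assumes "d \<ge> 4" and "k \<ge> 1" and "\<And>i. i \<in> {1..d - 1} \<Longrightarrow> n i \<ge> 1"
  shows "real (card (parallelogram_polyhypercubes d k n)) =
           1 / real k ^ (d - 1) *
           (\<Prod>i=1..d - 1. real (n i) / (real (n i) + real k - 1) *
              (real ((n i + k - 1) choose (k - 1)))\<^sup>2)"
proof -
  let ?c = "\<lambda>i. card (dominated_pairs (k - 1) (n i - 1) (n i - 1))"
  have "card (parallelogram_polyhypercubes d k n) =
      card (\<Pi>\<^sub>E r\<in>{2..d}. dominated_pairs (k - 1) (n (r - 1) - 1) (n (r - 1) - 1))"
    using bij_betw_same_card[OF bij_betw_parallelogram_polyhypercubes[of d k n]] assms by simp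
  also have "\<dots> = (\<Prod>r=2..d. ?c (r - 1))"
    by (simp add: card_PiE)
  also have "\<dots> = (\<Prod>i=1..d - 1. ?c i)"
    by (rule prod.reindex_bij_witness[where i = "\<lambda>i. i + 1" and j = "\<lambda>r. r - 1"]) auto
  also have "real \<dots> = (\<Prod>i=1..d - 1. 1 / real k * (real (n i) / (real (n i) + real k - 1) *
      (real ((n i + k - 1) choose (k - 1)))\<^sup>2))"
    unfolding of_nat_prod
  proof (rule prod.cong[OF refl])
    fix i assume "i \<in> {1..d - 1}"
    with assms have "n i \<ge> 1" by blast
    have "real (?c i) = real_of_int (int (?c i))" by simp
    also have "\<dots> = real_of_int (dominated_count (k - 1) (n i - 1) (n i - 1))"
      by (subst card_dominated_pairs) auto
    finally show "real (?c i) = 1 / real k * (real (n i) / (real (n i) + real k - 1) *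
        (real ((n i + k - 1) choose (k - 1)))\<^sup>2)"
      using dominated_count_diagonal[OF assms(2) \<open>n i \<ge> 1\<close>] by simp
  qed
  \<comment> \<open>The \<open>d - 1\<close> factors \<open>1 / real k\<close>, one per direction,
    collect to the power in front.\<close>
  finally show ?thesis
    by (simp add: prod.distrib power_divide prod_dividef)
qed

end
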